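(* Let $X$ be the simplicial complex on vertex set $\{0,1,\dots,9\}$ with the $14$ facets $$1249,\ 1269,\ 1569,\ 1589,\ 1489,\ 1458,\ 1457,\ 4578,\ 1256,\ 0125,\ 0256,\ 0123,\ 1234,\ 1347,$$ and let $A$ be its subcomplex with facets $026,\ 023,\ 234,\ 347,\ 478$. Then the simplicial complex $C_3$ obtained by gluing together three copies of $X$ along $A$ is Cohen--Macaulay and non-partitionable.
   Context: The notation $v_1\cdots v_k$ abbreviates the set $\{v_1,\dots,v_k\}$. A simplicial complex is a finite collection of subsets (faces) of a finite set closed under taking subsets; facets are maximal faces, and the complex with given facets consists of all subsets of those facets. $\dim\sigma=|\sigma|-1$ and $\dim\Delta$ is the maximum dimension of a face. The subcomplex $A$ is the induced subcomplex of $X$ on $\{0,2,3,4,6,7,8\}$. Gluing: take the stated number of copies of $X$ on disjoint vertex sets and, for each vertex $v$ of $A$, identify all copies of $v$ to a single vertex. Since $A$ is induced, the result is a simplicial complex whose faces are the images of the faces of the copies of $X$, and any two copies of $X$ intersect exactly in $A$. Link: $\mathrm{link}_\Delta(\sigma)=\{\tau\in\Delta : \tau\cap\sigma=\emptyset,\ \tau\cup\sigma\in\Delta\}$. A simplicial complex $\Delta$ is Cohen--Macaulay if for every $\sigma\in\Delta$ (including $\emptyset$), $\tilde H_i(\mathrm{link}_\Delta(\sigma))=0$ for all $i<\dim\mathrm{link}_\Delta(\sigma)$, where $\tilde H_i$ is reduced simplicial homology with coefficients in $\mathbb{Z}$. A pure simplicial complex $\Delta$ (all facets of the same dimension) with facets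 $F_1,\dots,F_n$ is partitionable if there exist faces $R_i\subseteq F_i$ such that $\Delta=\bigsqcup_{i=1}^n[R_i,F_i]$ (disjoint union), where $[R_i,F_i]=\{\sigma\in\Delta : R_i\subseteq\sigma\subseteq F_i\}$. *)

theory Defs
  imports
    "HOL-Algebra.Free_Abelian_Groups"
    "HOL-Algebra.Elementary_Groups"
    "HOL-Library.Disjoint_Sets"
    "HOL-Library.Nat_Bijection"
begin

section \<open>Simplicial complexes\<close>

definition abstract_simplicial_complex :: "'a set set \<Rightarrow> bool" where
  "abstract_simplicial_complex \<Delta> \<longleftrightarrow>
     finite \<Delta> \<and> (\<forall>\<sigma>\<in>\<Delta>. finite \<sigma>) \<and> (\<forall>\<sigma>\<in>\<Delta>. \<forall>\<tau>. \<tau> \<subseteq> \<sigma> \<longrightarrow> \<tau> \<in> \<Delta>)"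

definition complex_of :: "'a set set \<Rightarrow> 'a set set" where
  "complex_of \<F> = {\<sigma>. \<exists>F\<in>\<F>. \<sigma> \<subseteq> F}"

definition facets :: "'a set set \<Rightarrow> 'a set set" where
  "facets \<Delta> = {F\<in>\<Delta>. \<forall>G\<in>\<Delta>. F \<subseteq> G \<longrightarrow> G = F}"

definition induced_subcomplex :: "'a set set \<Rightarrow> 'a set \<Rightarrow> 'a set set" where
  "induced_subcomplex \<Delta> W = {\<sigma>\<in>\<Delta>. \<sigma> \<subseteq> W}"

text \<open>Dimensions are integers, so that the empty face has dimension \<open>-1\<close>.\<close>

definition face_dim :: "'a set \<Rightarrow> int" where
  "face_dim \<sigma> = int (card \<sigma>) - 1"

definition complex_dim :: "'a set set \<Rightarrow> int" where
  "complex_dim \<Delta> = Max (face_dim ` \<Delta>)"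

definition pure_complex :: "'a set set \<Rightarrow> bool" where
  "pure_complex \<Delta> \<longleftrightarrow> (\<forall>F\<in>facets \<Delta>. \<forall>G\<in>facets \<Delta>. face_dim F = face_dim G)"

definition link :: "'a set set \<Rightarrow> 'a set \<Rightarrow> 'a set set" where
  "link \<Delta> \<sigma> = {\<tau>\<in>\<Delta>. \<tau> \<inter> \<sigma> = {} \<and> \<tau> \<union> \<sigma> \<in> \<Delta>}"


section \<open>Reduced simplicial homology with integer coefficients\<close>

text \<open>
  Every face is oriented by the linear order on the vertices. The group in degree \<open>-1\<close> is
  generated by the empty face, so that the boundary map out of degree \<open>0\<close> is the augmentation
  and the homology is the reduced one. The groups in all degrees below \<open>-1\<close> are trivial.
\<close>

definition simplicial_chain_group :: "'a set set \<Rightarrow> int \<Rightarrow> ('a set \<Rightarrow>\<^sub>0 int) monoid" where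
  "simplicial_chain_group \<Delta> i = free_Abelian_group {\<sigma>\<in>\<Delta>. face_dim \<sigma> = i}"

definition face_boundary :: "'a::linorder set \<Rightarrow> 'a set \<Rightarrow>\<^sub>0 int" where
  "face_boundary \<sigma> = (\<Sum>v\<in>\<sigma>. frag_cmul ((-1) ^ card {w\<in>\<sigma>. w < v}) (frag_of (\<sigma> - {v})))"

definition simplicial_boundary :: "('a::linorder set \<Rightarrow>\<^sub>0 int) \<Rightarrow> 'a set \<Rightarrow>\<^sub>0 int" where
  "simplicial_boundary = frag_extend face_boundary"

definition simplicial_cycles :: "'a::linorder set set \<Rightarrow> int \<Rightarrow> ('a set \<Rightarrow>\<^sub>0 int) set" where
  "simplicial_cycles \<Delta> i =
     kernel (simplicial_chain_group \<Delta> i) (simplicial_chain_group \<Delta> (i - 1)) simplicial_boundary"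

definition simplicial_boundaries :: "'a::linorder set set \<Rightarrow> int \<Rightarrow> ('a set \<Rightarrow>\<^sub>0 int) set" where
  "simplicial_boundaries \<Delta> i = simplicial_boundary ` carrier (simplicial_chain_group \<Delta> (i + 1))"

definition reduced_simplicial_homology ::
    "'a::linorder set set \<Rightarrow> int \<Rightarrow> ('a set \<Rightarrow>\<^sub>0 int) set monoid" where
  "reduced_simplicial_homology \<Delta> i =
     subgroup_generated (simplicial_chain_group \<Delta> i) (simplicial_cycles \<Delta> i)
       Mod simplicial_boundaries \<Delta> i"

lemma face_boundary_squared:
  assumes "finite \<sigma>"
  shows "simplicial_boundary (face_boundary \<sigma>) = 0"
proof -
  define s where "s \<tau> v = (-1 :: int) ^ card {w\<in>\<tau>. w < v}" for \<tau> and v :: 'a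
  define f where "f v w = frag_cmul (s \<sigma> v * s (\<sigma> - {v}) w) (frag_of (\<sigma> - {v} - {w}))" for v w
  have anti: "f v w = - f w v" if "v \<in> \<sigma>" "w \<in> \<sigma>" "v < w" for v w
  proof -
    have "{u\<in>\<sigma>. u < w} = insert v {u\<in>\<sigma> - {v}. u < w}" using that by auto
    then have "card {u\<in>\<sigma>. u < w} = Suc (card {u\<in>\<sigma> - {v}. u < w})"
      using assms by simp
    moreover have "{u\<in>\<sigma> - {w}. u < v} = {u\<in>\<sigma>. u < v}" using that by auto
    ultimately have "s \<sigma> v * s (\<sigma> - {v}) w = - (s \<sigma> w * s (\<sigma> - {w}) v)"
      by (simp add: s_def)
    moreover have "\<sigma> - {v} - {w} = \<sigma> - {w} - {v}" by auto
    ultimately show ?thesis by (simp add: f_def)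
  qed
  let ?P = "{(v, w). v \<in> \<sigma> \<and> w \<in> \<sigma> \<and> v < w}" and ?Q = "{(v, w). v \<in> \<sigma> \<and> w \<in> \<sigma> \<and> w < v}"
  have fin: "finite ?P" "finite ?Q"
    by (rule finite_subset [of _ "\<sigma> \<times> \<sigma>"]; use assms in auto)+
  have "simplicial_boundary (face_boundary \<sigma>) = (\<Sum>v\<in>\<sigma>. \<Sum>w\<in>\<sigma> - {v}. f v w)"
    using assms
    by (simp add: face_boundary_def simplicial_boundary_def frag_extend_sum frag_extend_cmul
        frag_cmul_sum f_def s_def)
  also have "\<dots> = (\<Sum>(v, w)\<in>Sigma \<sigma> (\<lambda>v. \<sigma> - {v}). f v w)"
    using assms by (simp add: sum.Sigma)
  also have "\<dots> = (\<Sum>(v, w)\<in>?P \<union> ?Q. f v w)"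
    by (rule sum.cong) auto
  also have "\<dots> = (\<Sum>(v, w)\<in>?P. f v w) + (\<Sum>(v, w)\<in>?Q. f v w)"
    by (rule sum.union_disjoint [OF fin]) auto
  also have "(\<Sum>(v, w)\<in>?Q. f v w) = (\<Sum>(v, w)\<in>?P. - f v w)"
    by (rule sum.reindex_bij_witness [of _ prod.swap prod.swap]) (auto simp: anti)
  also have "(\<Sum>(v, w)\<in>?P. f v w) + \<dots> = 0"
    by (simp add: split_def sum_negf)
  finally show ?thesis .
qed

lemma simplicial_boundary_squared:
  assumes "\<And>\<sigma>. \<sigma> \<in> Poly_Mapping.keys c \<Longrightarrow> finite \<sigma>"
  shows "simplicial_boundary (simplicial_boundary c) = 0"
proof -
  have "simplicial_boundary (simplicial_boundary c) =
      (\<Sum>\<sigma>\<in>Poly_Mapping.keys c.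
        frag_cmul (Poly_Mapping.lookup c \<sigma>) (simplicial_boundary (face_boundary \<sigma>)))"
    unfolding simplicial_boundary_def frag_extend_def [of _ c]
    by (simp add: frag_extend_sum frag_extend_cmul)
  then show ?thesis using assms by (simp add: face_boundary_squared)
qed

lemma face_boundary_keys:
  assumes "abstract_simplicial_complex \<Delta>" "\<sigma> \<in> \<Delta>" "face_dim \<sigma> = i"
  shows "Poly_Mapping.keys (face_boundary \<sigma>) \<subseteq> {\<tau>\<in>\<Delta>. face_dim \<tau> = i - 1}"
proof -
  have fin: "finite \<sigma>" using assms by (auto simp: abstract_simplicial_complex_def)
  have "Poly_Mapping.keys (face_boundary \<sigma>) \<subseteq> (\<lambda>v. \<sigma> - {v}) ` \<sigma>"
    unfolding face_boundary_def using keys_sum [of _ \<sigma>] keys_cmul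
    by (fastforce dest: subsetD)
  moreover have "\<sigma> - {v} \<in> \<Delta> \<and> face_dim (\<sigma> - {v}) = i - 1" if "v \<in> \<sigma>" for v
  proof
    show "\<sigma> - {v} \<in> \<Delta>" using assms by (auto simp: abstract_simplicial_complex_def)
    have "card \<sigma> = Suc (card (\<sigma> - {v}))" using fin that by (metis card.remove)
    then show "face_dim (\<sigma> - {v}) = i - 1" using assms(3) by (simp add: face_dim_def)
  qed
  ultimately show ?thesis by auto
qed

lemma simplicial_boundary_hom:
  assumes "abstract_simplicial_complex \<Delta>"
  shows "simplicial_boundary \<in>
    hom (simplicial_chain_group \<Delta> i) (simplicial_chain_group \<Delta> (i - 1))"
proof (rule homI)
  fix c assume "c \<in> carrier (simplicial_chain_group \<Delta> i)"
  then have "Poly_Mapping.keys c \<subseteq> {\<sigma>\<in>\<Delta>. face_dim \<sigma> = i}"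
    by (simp add: simplicial_chain_group_def)
  then have "Poly_Mapping.keys (simplicial_boundary c) \<subseteq> {\<tau>\<in>\<Delta>. face_dim \<tau> = i - 1}"
    unfolding simplicial_boundary_def using keys_frag_extend [of face_boundary c]
      face_boundary_keys [OF assms] by blast
  then show "simplicial_boundary c \<in> carrier (simplicial_chain_group \<Delta> (i - 1))"
    by (simp add: simplicial_chain_group_def)
qed (simp add: simplicial_chain_group_def simplicial_boundary_def frag_extend_add)

lemma trivial_reduced_simplicial_homology_iff:
  assumes "abstract_simplicial_complex \<Delta>"
  shows "trivial_group (reduced_simplicial_homology \<Delta> i) \<longleftrightarrow>
    simplicial_cycles \<Delta> i = simplicial_boundaries \<Delta> i"
proof -
  let ?C = "simplicial_chain_group \<Delta>" and ?Z = "simplicial_cycles \<Delta> i"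
    and ?B = "simplicial_boundaries \<Delta> i"
  let ?G = "subgroup_generated (?C i) ?Z"
  have comm: "comm_group (?C j)" for j
    by (simp add: simplicial_chain_group_def abelian_free_Abelian_group)
  then have grp: "group (?C j)" for j by (simp add: comm_group_def)
  interpret d: group_hom "?C i" "?C (i - 1)" simplicial_boundary
    by (intro group_hom.intro group_hom_axioms.intro grp simplicial_boundary_hom assms)
  interpret d': group_hom "?C (i + 1)" "?C i" simplicial_boundary
    using simplicial_boundary_hom [OF assms, of "i + 1"]
    by (intro group_hom.intro group_hom_axioms.intro grp) simp
  interpret Z: subgroup ?Z "?C i"
    unfolding simplicial_cycles_def by (rule d.subgroup_kernel)
  have B: "subgroup ?B (?C i)"
    unfolding simplicial_boundaries_def by (rule d'.img_is_subgroup)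
  have car: "carrier ?G = ?Z" by (rule Z.carrier_subgroup_generated_subgroup)
  have fin: "finite \<sigma>" if "c \<in> carrier (?C j)" "\<sigma> \<in> Poly_Mapping.keys c" for c j \<sigma>
    using that assms by (auto simp: simplicial_chain_group_def abstract_simplicial_complex_def)
  have BZ: "?B \<subseteq> ?Z"
  proof
    fix b assume "b \<in> ?B"
    then obtain c where c: "c \<in> carrier (?C (i + 1))" "b = simplicial_boundary c"
      by (auto simp: simplicial_boundaries_def)
    have "simplicial_boundary b = 0"
      unfolding c by (rule simplicial_boundary_squared) (rule fin [OF c(1)])
    then show "b \<in> ?Z"
      using d'.hom_closed [OF c(1)] c(2)
      by (simp add: simplicial_cycles_def kernel_def simplicial_chain_group_def)
  qed
  interpret G: comm_group ?G
    using comm by (simp add: group.abelian_subgroup_generated [OF grp])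
  have BG: "subgroup ?B ?G"
    using B BZ by (simp add: group.subgroup_of_subgroup_generated [OF grp])
  then interpret B: normal ?B ?G by (rule G.subgroup_imp_normal)
  show ?thesis
  proof
    assume "trivial_group (reduced_simplicial_homology \<Delta> i)"
    then have "carrier (?G Mod ?B) = {?B}"
      by (simp add: trivial_group_def reduced_simplicial_homology_def)
    then have "?B #>\<^bsub>?G\<^esub> z = ?B" if "z \<in> ?Z" for z
      using that car by (auto simp: carrier_FactGroup)
    then have "?Z \<subseteq> ?B"
      using car BG by (metis G.rcos_self subsetI)
    with BZ show "?Z = ?B" by simp
  next
    assume eq: "?Z = ?B"
    have "?B #>\<^bsub>?G\<^esub> z = ?B" if "z \<in> carrier ?G" for z
    proof (rule G.coset_join2 [OF that BG])
      show "z \<in> ?B" using that unfolding car unfolding eq .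
    qed
    then have "carrier (?G Mod ?B) = {?B}"
      unfolding carrier_FactGroup using G.one_closed by blast
    then show "trivial_group (reduced_simplicial_homology \<Delta> i)"
      using B.factorgroup_is_group by (simp add: trivial_group_def reduced_simplicial_homology_def)
  qed
qed


section \<open>Cohen--Macaulay and partitionable complexes\<close>

definition cohen_macaulay :: "'a::linorder set set \<Rightarrow> bool" where
  "cohen_macaulay \<Delta> \<longleftrightarrow>
     (\<forall>\<sigma>\<in>\<Delta>. \<forall>i < complex_dim (link \<Delta> \<sigma>).
        trivial_group (reduced_simplicial_homology (link \<Delta> \<sigma>) i))"

definition face_interval :: "'a set set \<Rightarrow> 'a set \<Rightarrow> 'a set \<Rightarrow> 'a set set" where
  "face_interval \<Delta> R F = {\<sigma>\<in>\<Delta>. R \<subseteq> \<sigma> \<and> \<sigma> \<subseteq> F}"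

text \<open>
  Partitionability is a notion for pure complexes. Purity is not made a conjunct here, so that
  non-partitionability always means that no partition exists and never just that
  \<open>\<Delta>\<close> is not pure.
\<close>

definition partitionable :: "'a set set \<Rightarrow> bool" where
  "partitionable \<Delta> \<longleftrightarrow>
     (\<exists>R. (\<forall>F\<in>facets \<Delta>. R F \<in> \<Delta> \<and> R F \<subseteq> F) \<and>
          disjoint_family_on (\<lambda>F. face_interval \<Delta> (R F) F) (facets \<Delta>) \<and>
          \<Delta> = (\<Union>F\<in>facets \<Delta>. face_interval \<Delta> (R F) F))"


section \<open>Gluing copies of a complex along a subcomplex\<close>

text \<open>
  The vertex \<open>v\<close> of the \<open>j\<close>-th copy is encoded as \<open>prod_encode (j, v)\<close>. All copies of a vertex
  of \<open>A\<close> are identified by using the copy with index \<open>0\<close> as their common representative.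
\<close>

definition glue_vertex :: "nat set set \<Rightarrow> nat \<Rightarrow> nat \<Rightarrow> nat" where
  "glue_vertex A j v = (if v \<in> \<Union>A then prod_encode (0, v) else prod_encode (j, v))"

definition glue_copies :: "nat \<Rightarrow> nat set set \<Rightarrow> nat set set \<Rightarrow> nat set set" where
  "glue_copies k \<Delta> A = (\<Union>j<k. (\<lambda>\<sigma>. glue_vertex A j ` \<sigma>) ` \<Delta>)"

lemma glue_vertex_eq_iff:
  "glue_vertex A j v = glue_vertex A j' v' \<longleftrightarrow> v = v' \<and> (j = j' \<or> v \<in> \<Union>A)"
  by (auto simp: glue_vertex_def)


section \<open>The complex\<close>

definition X_facets :: "nat set set" where
  "X_facets =
     {{1,2,4,9}, {1,2,6,9}, {1,5,6,9}, {1,5,8,9}, {1,4,8,9}, {1,4,5,8}, {1,4,5,7},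
      {4,5,7,8}, {1,2,5,6}, {0,1,2,5}, {0,2,5,6}, {0,1,2,3}, {1,2,3,4}, {1,3,4,7}}"

definition A_facets :: "nat set set" where
  "A_facets = {{0,2,6}, {0,2,3}, {2,3,4}, {3,4,7}, {4,7,8}}"

definition X_complex :: "nat set set" where "X_complex = complex_of X_facets"

definition A_complex :: "nat set set" where "A_complex = complex_of A_facets"

definition C3 :: "nat set set" where "C3 = glue_copies 3 X_complex A_complex"


subsection \<open>Basic properties of these complexes\<close>

lemma facets_complex_of:
  assumes "\<And>F. F \<in> \<F> \<Longrightarrow> finite F \<and> card F = n"
  shows "facets (complex_of \<F>) = \<F>"
proof
  show "facets (complex_of \<F>) \<subseteq> \<F>"
    by (auto simp: facets_def complex_of_def)
  show "\<F> \<subseteq> facets (complex_of \<F>)"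
  proof
    fix F assume F: "F \<in> \<F>"
    have "G = F" if "G \<subseteq> H" "H \<in> \<F>" "F \<subseteq> G" for G H
    proof -
      have "F = H" using that assms F by (metis card_subset_eq order_trans)
      then show ?thesis using that by auto
    qed
    then show "F \<in> facets (complex_of \<F>)" using F by (auto simp: facets_def complex_of_def)
  qed
qed

lemma abstract_simplicial_complex_complex_of:
  assumes "finite \<F>" "\<And>F. F \<in> \<F> \<Longrightarrow> finite F"
  shows "abstract_simplicial_complex (complex_of \<F>)"
proof -
  have "complex_of \<F> = (\<Union>F\<in>\<F>. Pow F)" by (auto simp: complex_of_def)
  then have "finite (complex_of \<F>)" using assms by simp
  then show ?thesis using assms
    by (auto simp: abstract_simplicial_complex_def complex_of_def intro: finite_subset)
qed

lemma X_facets_card: "F \<in> X_facets \<Longrightarrow> finite F \<and> card F = 4"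
proof -
  have "\<forall>F\<in>X_facets. finite F \<and> card F = 4" by (simp add: X_facets_def)
  then show "F \<in> X_facets \<Longrightarrow> finite F \<and> card F = 4" by blast
qed

lemma A_facets_card: "F \<in> A_facets \<Longrightarrow> finite F \<and> card F = 3"
proof -
  have "\<forall>F\<in>A_facets. finite F \<and> card F = 3" by (simp add: A_facets_def)
  then show "F \<in> A_facets \<Longrightarrow> finite F \<and> card F = 3" by blast
qed

lemma facets_X: "facets X_complex = X_facets"
  unfolding X_complex_def by (rule facets_complex_of [OF X_facets_card])

lemma facets_A: "facets A_complex = A_facets"
  unfolding A_complex_def by (rule facets_complex_of [OF A_facets_card])

lemma vertices_A: "\<Union>A_complex = {0,2,3,4,6,7,8}"
proof -
  have "\<Union>A_complex = \<Union>A_facets" by (auto simp: A_complex_def complex_of_def)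
  also have "\<dots> = {0,2,3,4,6,7,8}" unfolding A_facets_def by blast
  finally show ?thesis .
qed

lemma A_induced: "A_complex = induced_subcomplex X_complex {0,2,3,4,6,7,8}"
proof (intro equalityI subsetI)
  fix \<sigma> assume \<sigma>: "\<sigma> \<in> A_complex"
  then obtain F where F: "F \<in> A_facets" "\<sigma> \<subseteq> F"
    unfolding A_complex_def complex_of_def by blast
  have "\<forall>F\<in>A_facets. \<exists>G\<in>X_facets. F \<subseteq> G"
    by (simp add: A_facets_def X_facets_def)
  with F obtain G where "G \<in> X_facets" "\<sigma> \<subseteq> G" by (meson order_trans)
  then have "\<sigma> \<in> X_complex" unfolding X_complex_def complex_of_def by blast
  moreover have "\<sigma> \<subseteq> {0,2,3,4,6,7,8}" unfolding vertices_A [symmetric] using \<sigma> by (rule Union_upper)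
  ultimately show "\<sigma> \<in> induced_subcomplex X_complex {0,2,3,4,6,7,8}"
    unfolding induced_subcomplex_def by (intro CollectI conjI)
next
  fix \<sigma> assume \<sigma>: "\<sigma> \<in> induced_subcomplex X_complex {0,2,3,4,6,7,8}"
  then have "\<sigma> \<in> X_complex" and W: "\<sigma> \<subseteq> {0,2,3,4,6,7,8}"
    by (simp_all only: induced_subcomplex_def mem_Collect_eq)
  then obtain F where F: "F \<in> X_facets" "\<sigma> \<subseteq> F"
    unfolding X_complex_def complex_of_def by (elim CollectE bexE)
  have "\<forall>F\<in>X_facets. \<exists>G\<in>A_facets. F \<inter> {0,2,3,4,6,7,8} \<subseteq> G"
    by (simp add: A_facets_def X_facets_def)
  with F(1) obtain G where G: "G \<in> A_facets" "F \<inter> {0,2,3,4,6,7,8} \<subseteq> G" by (meson bspec)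
  have "\<sigma> \<subseteq> G" using Int_greatest [OF F(2) W] G(2) by (rule order_trans)
  then show "\<sigma> \<in> A_complex" unfolding A_complex_def complex_of_def using G(1) by (intro CollectI bexI)
qed

definition C3_facets :: "nat set set" where
  "C3_facets = (\<Union>j<3. (\<lambda>F. glue_vertex A_complex j ` F) ` X_facets)"

lemma C3_facets_card: "F \<in> C3_facets \<Longrightarrow> finite F \<and> card F = 4"
proof -
  have "inj (glue_vertex A_complex j)" for j by (simp add: inj_def glue_vertex_eq_iff)
  then have "card (glue_vertex A_complex j ` F) = card F" for j F
    by (meson card_image inj_on_subset subset_UNIV)
  then show "F \<in> C3_facets \<Longrightarrow> finite F \<and> card F = 4"
    using X_facets_card by (auto simp: C3_facets_def)
qed

lemma C3_eq: "C3 = complex_of C3_facets"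
proof -
  have "(\<lambda>\<sigma>. f ` \<sigma>) ` complex_of \<F> = complex_of ((\<lambda>F. f ` F) ` \<F>)" for f :: "nat \<Rightarrow> nat" and \<F>
    by (auto simp: complex_of_def subset_image_iff)
  then show ?thesis
    unfolding C3_def glue_copies_def X_complex_def C3_facets_def by (auto simp only: complex_of_def UN_iff)
qed

lemma facets_C3: "facets C3 = C3_facets"
  unfolding C3_eq by (rule facets_complex_of [OF C3_facets_card])

lemma abstract_simplicial_complex_C3: "abstract_simplicial_complex C3"
  unfolding C3_eq
proof (rule abstract_simplicial_complex_complex_of)
  show "finite C3_facets" by (simp add: C3_facets_def X_facets_def)
  show "finite F" if "F \<in> C3_facets" for F using C3_facets_card [OF that] by simp
qed

lemma pure_C3: "pure_complex C3"
  unfolding pure_complex_def facets_C3 using C3_facets_card by (simp add: face_dim_def)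

end

theory Submission
  imports Defs
begin

text \<open>
  Both \<open>X\<close> and \<open>A\<close> are shellable in the given order of their facets, so \<open>C3\<close>, obtained by
  gluing complexes of dimension 3 along complexes of dimension 2, is constructible. Links in a union
  are unions of links, hence the Mayer--Vietoris argument shows inductively that all links in a
  constructible complex have no homology below the top degree.

  A partition of \<open>C3\<close> must cover every face of a copy of \<open>X\<close> outside \<open>A\<close> by intervals of that
  copy. If such intervals cover neither \<open>26\<close> nor \<open>48\<close>, then the vertex \<open>5\<close> is covered twice:
  covering \<open>269\<close> forces \<open>9\<close> into the lower end of the interval of \<open>1269\<close>, so \<open>126\<close> is covered by
  \<open>1256\<close>, whose lower end contains \<open>1\<close>; then \<open>25\<close> is covered by \<open>0125\<close> or \<open>0256\<close>, which also
  cover \<open>015\<close> and \<open>056\<close>, respectively, so that the interval in question contains \<open>5\<close>. By symmetry so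
  does the interval of \<open>1457\<close> or of \<open>4578\<close>. Hence each of the three copies covers \<open>26\<close> or \<open>48\<close>, and by
  the pigeonhole principle two copies cover the same face of \<open>A\<close>.
\<close>

lemma abstract_simplicial_complexD:
  assumes "abstract_simplicial_complex \<Delta>"
  shows "finite \<Delta>" "\<sigma> \<in> \<Delta> \<Longrightarrow> finite \<sigma>" "\<sigma> \<in> \<Delta> \<Longrightarrow> \<tau> \<subseteq> \<sigma> \<Longrightarrow> \<tau> \<in> \<Delta>"
  using assms unfolding abstract_simplicial_complex_def by blast+


section \<open>Vanishing of homology below a given degree\<close>

text \<open>Vanishing reduced homology in degrees below \<open>k\<close>, phrased on chains and not
  on quotient groups: chains of different subcomplexes share one type and can be added
  directly.\<close>

definition acyclic_below :: "int \<Rightarrow> 'a::linorder set set \<Rightarrow> bool" where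
  "acyclic_below k \<Delta> \<longleftrightarrow>
     (\<forall>i<k. \<forall>c. Poly_Mapping.keys c \<subseteq> {\<sigma>\<in>\<Delta>. face_dim \<sigma> = i} \<longrightarrow> simplicial_boundary c = 0 \<longrightarrow>
        (\<exists>b. Poly_Mapping.keys b \<subseteq> {\<sigma>\<in>\<Delta>. face_dim \<sigma> = i + 1} \<and> simplicial_boundary b = c))"

lemma acyclic_belowD:
  assumes "acyclic_below k \<Delta>" "i < k"
    "Poly_Mapping.keys c \<subseteq> {\<sigma>\<in>\<Delta>. face_dim \<sigma> = i}" "simplicial_boundary c = 0"
  obtains b where "Poly_Mapping.keys b \<subseteq> {\<sigma>\<in>\<Delta>. face_dim \<sigma> = i + 1}" "simplicial_boundary b = c"
  using assms unfolding acyclic_below_def by blast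

lemma simplicial_boundary_add:
  "simplicial_boundary (a + b) = simplicial_boundary a + simplicial_boundary b"
  by (simp add: simplicial_boundary_def frag_extend_add)

lemma simplicial_boundary_diff:
  "simplicial_boundary (a - b) = simplicial_boundary a - simplicial_boundary b"
  by (simp add: simplicial_boundary_def frag_extend_diff)

lemma simplicial_boundary_keys:
  assumes "abstract_simplicial_complex \<Delta>" "Poly_Mapping.keys c \<subseteq> {\<sigma>\<in>\<Delta>. face_dim \<sigma> = i}"
  shows "Poly_Mapping.keys (simplicial_boundary c) \<subseteq> {\<sigma>\<in>\<Delta>. face_dim \<sigma> = i - 1}"
  using hom_in_carrier [OF simplicial_boundary_hom [OF assms(1), of i], of c] assms(2)
  by (simp add: simplicial_chain_group_def)

lemma acyclic_below_trivial_homology: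
  assumes \<Delta>: "abstract_simplicial_complex \<Delta>" and "acyclic_below k \<Delta>" "i < k"
  shows "trivial_group (reduced_simplicial_homology \<Delta> i)"
proof -
  have "simplicial_cycles \<Delta> i \<subseteq> simplicial_boundaries \<Delta> i"
  proof
    fix c assume "c \<in> simplicial_cycles \<Delta> i"
    then have "Poly_Mapping.keys c \<subseteq> {\<sigma>\<in>\<Delta>. face_dim \<sigma> = i}" "simplicial_boundary c = 0"
      by (simp_all add: simplicial_cycles_def kernel_def simplicial_chain_group_def)
    then obtain b where "Poly_Mapping.keys b \<subseteq> {\<sigma>\<in>\<Delta>. face_dim \<sigma> = i + 1}" "simplicial_boundary b = c"
      by (rule acyclic_belowD [OF assms(2,3)])
    then show "c \<in> simplicial_boundaries \<Delta> i"
      unfolding simplicial_boundaries_def simplicial_chain_group_def carrier_free_Abelian_group_iff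
      by (intro image_eqI [of _ _ b]) simp_all
  qed
  moreover have "simplicial_boundaries \<Delta> i \<subseteq> simplicial_cycles \<Delta> i"
  proof
    fix c assume "c \<in> simplicial_boundaries \<Delta> i"
    then obtain b where c: "c = simplicial_boundary b"
      and "b \<in> carrier (simplicial_chain_group \<Delta> (i + 1))"
      unfolding simplicial_boundaries_def by (rule imageE)
    then have b: "Poly_Mapping.keys b \<subseteq> {\<sigma>\<in>\<Delta>. face_dim \<sigma> = i + 1}"
      by (simp add: simplicial_chain_group_def)
    have "finite \<sigma>" if "\<sigma> \<in> Poly_Mapping.keys b" for \<sigma>
      using that b by (intro abstract_simplicial_complexD(2) [OF \<Delta>]) auto
    then have "simplicial_boundary c = 0" unfolding c by (rule simplicial_boundary_squared)
    moreover have "Poly_Mapping.keys c \<subseteq> {\<sigma>\<in>\<Delta>. face_dim \<sigma> = i}"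
      using simplicial_boundary_keys [OF \<Delta> b] c by simp
    ultimately show "c \<in> simplicial_cycles \<Delta> i"
      by (simp add: simplicial_cycles_def kernel_def simplicial_chain_group_def)
  qed
  ultimately show ?thesis
    by (simp add: trivial_reduced_simplicial_homology_iff [OF \<Delta>])
qed

text \<open>Mayer--Vietoris on chains. When a cycle splits into a chain of \<open>\<Delta>\<close>
  plus a chain of \<open>\<Gamma>\<close>, the boundary of either part is a cycle of the
  intersection one degree lower, whence the bound \<open>k - 1\<close> there.\<close>

lemma acyclic_below_Un:
  assumes \<Delta>: "abstract_simplicial_complex \<Delta>" and \<Gamma>: "abstract_simplicial_complex \<Gamma>"
    and acyc: "acyclic_below k \<Delta>" "acyclic_below k \<Gamma>" "acyclic_below (k - 1) (\<Delta> \<inter> \<Gamma>)"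
  shows "acyclic_below k (\<Delta> \<union> \<Gamma>)"
  unfolding acyclic_below_def
proof (intro allI impI)
  fix i c
  let ?F = "\<lambda>\<Delta> i. {\<sigma>\<in>\<Delta>. face_dim \<sigma> = i}"
  assume "i < k" and "Poly_Mapping.keys c \<subseteq> ?F (\<Delta> \<union> \<Gamma>) i" and dc: "simplicial_boundary c = 0"
  then have "Poly_Mapping.keys c \<subseteq> ?F \<Delta> i \<union> ?F \<Gamma> i" by blast
  then obtain a b where a: "Poly_Mapping.keys a \<subseteq> ?F \<Delta> i" and b: "Poly_Mapping.keys b \<subseteq> ?F \<Gamma> i"
    and c: "a + b = c"
    by (rule frag_split)
  have ab: "simplicial_boundary b = - simplicial_boundary a"
    using dc by (simp add: c [symmetric] simplicial_boundary_add eq_neg_iff_add_eq_0 add.commute)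
  have "Poly_Mapping.keys (simplicial_boundary a) \<subseteq> ?F (\<Delta> \<inter> \<Gamma>) (i - 1)"
    using simplicial_boundary_keys [OF \<Delta> a] simplicial_boundary_keys [OF \<Gamma> b]
    unfolding ab by auto
  moreover have "simplicial_boundary (simplicial_boundary a) = 0"
    by (rule simplicial_boundary_squared) (use a in \<open>auto intro!: abstract_simplicial_complexD(2) [OF \<Delta>]\<close>)
  \<comment> \<open>The chain \<open>w\<close> of the intersection corrects both parts at once:
    \<open>a - w\<close> and \<open>b + w\<close> are cycles and still add up to
    \<open>c\<close>.\<close>
  ultimately obtain w where w: "Poly_Mapping.keys w \<subseteq> ?F (\<Delta> \<inter> \<Gamma>) i"
    and dw: "simplicial_boundary w = simplicial_boundary a"
    using acyclic_belowD [OF acyc(3), of "i - 1" "simplicial_boundary a"] \<open>i < k\<close> by auto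
  have "Poly_Mapping.keys (a - w) \<subseteq> ?F \<Delta> i" "simplicial_boundary (a - w) = 0"
    using a w keys_diff [of a w] by (blast, simp add: simplicial_boundary_diff dw)
  then obtain x where x: "Poly_Mapping.keys x \<subseteq> ?F \<Delta> (i + 1)" "simplicial_boundary x = a - w"
    by (rule acyclic_belowD [OF acyc(1) \<open>i < k\<close>])
  have "Poly_Mapping.keys (b + w) \<subseteq> ?F \<Gamma> i" "simplicial_boundary (b + w) = 0"
    using b w keys_add [of b w] by (blast, simp add: simplicial_boundary_add dw ab)
  then obtain y where y: "Poly_Mapping.keys y \<subseteq> ?F \<Gamma> (i + 1)" "simplicial_boundary y = b + w"
    by (rule acyclic_belowD [OF acyc(2) \<open>i < k\<close>])
  have "Poly_Mapping.keys (x + y) \<subseteq> ?F (\<Delta> \<union> \<Gamma>) (i + 1)"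
    using x(1) y(1) keys_add [of x y] by blast
  moreover have "simplicial_boundary (x + y) = c"
    by (simp add: simplicial_boundary_add x(2) y(2) c [symmetric])
  ultimately show "\<exists>b. Poly_Mapping.keys b \<subseteq> ?F (\<Delta> \<union> \<Gamma>) (i + 1) \<and> simplicial_boundary b = c"
    by blast
qed

text \<open>
  Coning from the least vertex \<open>m\<close> is a chain contraction of the full simplex. With \<open>m\<close> least,
  no signs occur in the cone operator.
\<close>

definition cone_chain :: "'a \<Rightarrow> 'a set \<Rightarrow> 'a set \<Rightarrow>\<^sub>0 int" where
  "cone_chain m \<sigma> = (if m \<in> \<sigma> then 0 else frag_of (insert m \<sigma>))"

text \<open>The identity dh + hd = id for the cone operator h. If \<open>m\<close> lies in
  \<open>\<sigma>\<close>, the first summand vanishes and only the deletion of \<open>m\<close>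
  survives in the second; otherwise the boundary of the cone is \<open>\<sigma>\<close> minus the
  cone over the boundary of \<open>\<sigma>\<close>.\<close>

lemma cone_homotopy:
  fixes m :: "'a::linorder"
  assumes "finite \<sigma>" and least: "\<And>v. v \<in> \<sigma> \<Longrightarrow> m \<le> v"
  shows "simplicial_boundary (cone_chain m \<sigma>) + frag_extend (cone_chain m) (face_boundary \<sigma>) = frag_of \<sigma>"
proof -
  define s where "s v = (-1 :: int) ^ card {w\<in>\<sigma>. w < v}" for v
  have ext: "frag_extend (cone_chain m) (face_boundary \<sigma>) = (\<Sum>v\<in>\<sigma>. frag_cmul (s v) (cone_chain m (\<sigma> - {v})))"
    using assms(1) by (simp add: face_boundary_def frag_extend_sum frag_extend_cmul s_def)
  show ?thesis
  proof (cases "m \<in> \<sigma>")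
    case True
    have none: "{w\<in>\<sigma>. w < m} = {}" using least leD by blast
    have "(\<Sum>v\<in>\<sigma>. frag_cmul (s v) (cone_chain m (\<sigma> - {v}))) =
        frag_cmul (s m) (cone_chain m (\<sigma> - {m})) + (\<Sum>v\<in>\<sigma> - {m}. frag_cmul (s v) (cone_chain m (\<sigma> - {v})))"
      by (rule sum.remove [OF assms(1) True])
    also have "(\<Sum>v\<in>\<sigma> - {m}. frag_cmul (s v) (cone_chain m (\<sigma> - {v}))) = 0"
      by (rule sum.neutral) (use True in \<open>auto simp: cone_chain_def\<close>)
    also have "frag_cmul (s m) (cone_chain m (\<sigma> - {m})) = frag_of \<sigma>"
      using True by (simp add: cone_chain_def s_def none insert_absorb)
    finally show ?thesis
      using True unfolding ext by (simp add: cone_chain_def simplicial_boundary_def)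
  next
    case False
    have "face_boundary (insert m \<sigma>) =
        frag_cmul ((-1) ^ card {w\<in>insert m \<sigma>. w < m}) (frag_of (insert m \<sigma> - {m})) +
        (\<Sum>v\<in>\<sigma>. frag_cmul ((-1) ^ card {w\<in>insert m \<sigma>. w < v}) (frag_of (insert m \<sigma> - {v})))"
      unfolding face_boundary_def using assms(1) False by (rule sum.insert)
    also have "{w\<in>insert m \<sigma>. w < m} = {}" using least leD by blast
    also have "insert m \<sigma> - {m} = \<sigma>" using False by blast
    also have "(\<Sum>v\<in>\<sigma>. frag_cmul ((-1) ^ card {w\<in>insert m \<sigma>. w < v}) (frag_of (insert m \<sigma> - {v})))
        = (\<Sum>v\<in>\<sigma>. - frag_cmul (s v) (cone_chain m (\<sigma> - {v})))"
    proof (rule sum.cong [OF refl])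
      fix v assume v: "v \<in> \<sigma>"
      then have "m < v" using least False by (metis order_le_less)
      \<comment> \<open>The new least vertex moves every other vertex one position up, which flips
        all signs.\<close>
      then have "{w\<in>insert m \<sigma>. w < v} = insert m {w\<in>\<sigma>. w < v}" by auto
      then have "card {w\<in>insert m \<sigma>. w < v} = Suc (card {w\<in>\<sigma>. w < v})"
        using assms(1) False by simp
      moreover have "insert m \<sigma> - {v} = insert m (\<sigma> - {v})" using v False by auto
      ultimately show "frag_cmul ((-1) ^ card {w\<in>insert m \<sigma>. w < v}) (frag_of (insert m \<sigma> - {v}))
          = - frag_cmul (s v) (cone_chain m (\<sigma> - {v}))"
        using False by (simp add: cone_chain_def s_def)
    qed
    finally show ?thesis
      unfolding ext using False by (simp add: cone_chain_def simplicial_boundary_def sum_negf del: minus_frag_cmul)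
  qed
qed

text \<open>The bound is sharp for \<open>F = {}\<close>: the complex \<open>{{}}\<close> has
  nonzero reduced homology in degree -1, its dimension. A nonempty simplex is contracted by coning
  from its least vertex.\<close>

lemma acyclic_below_simplex:
  fixes F :: "'a::linorder set"
  assumes "finite F"
  shows "acyclic_below (face_dim F) (Pow F)"
  unfolding acyclic_below_def
proof (intro allI impI)
  fix i and c :: "'a set \<Rightarrow>\<^sub>0 int"
  assume i: "i < face_dim F" and c: "Poly_Mapping.keys c \<subseteq> {\<sigma>\<in>Pow F. face_dim \<sigma> = i}"
    and dc: "simplicial_boundary c = 0"
  show "\<exists>b. Poly_Mapping.keys b \<subseteq> {\<sigma>\<in>Pow F. face_dim \<sigma> = i + 1} \<and> simplicial_boundary b = c"
  proof (cases "F = {}")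
    case True
    then have "{\<sigma>\<in>Pow F. face_dim \<sigma> = i} = {}" using i by (auto simp: face_dim_def)
    with c have "Poly_Mapping.keys c = {}" by (metis subset_empty)
    then have "c = 0" by simp
    then show ?thesis by (intro exI [of _ 0]) (simp add: simplicial_boundary_def)
  next
    case False
    define m where "m = Min F"
    have m: "m \<in> F" "\<And>v. v \<in> F \<Longrightarrow> m \<le> v" using assms False by (simp_all add: m_def)
    \<comment> \<open>The homotopy identity extends from faces to chains by linearity. Its second
      summand vanishes on the cycle \<open>c\<close>, so the cone over \<open>c\<close> has boundary
      \<open>c\<close>.\<close>
    have "simplicial_boundary (frag_extend (cone_chain m) c)
        + frag_extend (cone_chain m) (simplicial_boundary c) = c"
      using c
    proof (induction c rule: frag_induction)
      case (one \<sigma>)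
      then have "finite \<sigma>" "\<And>v. v \<in> \<sigma> \<Longrightarrow> m \<le> v" using m(2) finite_subset [OF _ assms] by auto
      from cone_homotopy [OF this] show ?case by (simp add: simplicial_boundary_def)
    next
      case (diff a b)
      have "x - y + (u - v) = (x + u) - (y + v)" for x y u v :: "'a set \<Rightarrow>\<^sub>0 int"
        by simp
      with diff show ?case
        by (simp only: simplicial_boundary_diff frag_extend_diff)
    qed (simp add: simplicial_boundary_def)
    then have "simplicial_boundary (frag_extend (cone_chain m) c) = c" by (simp add: dc)
    moreover have "Poly_Mapping.keys (cone_chain m \<sigma>) \<subseteq> {\<sigma>\<in>Pow F. face_dim \<sigma> = i + 1}"
      if "\<sigma> \<in> Poly_Mapping.keys c" for \<sigma>
      using c that m(1) finite_subset [OF _ assms, of \<sigma>] by (auto simp: cone_chain_def face_dim_def)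
    then have "Poly_Mapping.keys (frag_extend (cone_chain m) c) \<subseteq> {\<sigma>\<in>Pow F. face_dim \<sigma> = i + 1}"
      using keys_frag_extend [of "cone_chain m" c] by blast
    ultimately show ?thesis by blast
  qed
qed


section \<open>Constructible complexes are Cohen--Macaulay\<close>

text \<open>The index \<open>n\<close> is the number of vertices of a facet, so that \<open>constructible 0\<close> only holds for
  \<open>{{}}\<close>.\<close>

inductive constructible :: "nat \<Rightarrow> 'a set set \<Rightarrow> bool" where
  simplex: "finite F \<Longrightarrow> card F = n \<Longrightarrow> constructible n (Pow F)"
| union: "constructible (Suc n) \<Delta> \<Longrightarrow> constructible (Suc n) \<Gamma> \<Longrightarrow> constructible n (\<Delta> \<inter> \<Gamma>) \<Longrightarrow>
    constructible (Suc n) (\<Delta> \<union> \<Gamma>)"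

lemma constructible_complex:
  "constructible n \<Delta> \<Longrightarrow> abstract_simplicial_complex \<Delta>"
proof (induction rule: constructible.induct)
  case (simplex F n)
  then show ?case
    using finite_subset [of _ F] by (auto simp: abstract_simplicial_complex_def)
next
  case (union n \<Delta> \<Gamma>)
  then show ?case unfolding abstract_simplicial_complex_def by blast
qed

lemma constructible_card:
  "constructible n \<Delta> \<Longrightarrow> \<sigma> \<in> \<Delta> \<Longrightarrow> card \<sigma> \<le> n"
  by (induction rule: constructible.induct) (auto intro: card_mono)

lemma constructible_empty_face:
  "constructible n \<Delta> \<Longrightarrow> {} \<in> \<Delta>"
  by (induction rule: constructible.induct) auto

lemma abstract_simplicial_complex_link:
  "abstract_simplicial_complex \<Delta> \<Longrightarrow> abstract_simplicial_complex (link \<Delta> \<sigma>)"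
proof -
  assume \<Delta>: "abstract_simplicial_complex \<Delta>"
  have "\<rho> \<in> link \<Delta> \<sigma>" if \<tau>: "\<tau> \<in> link \<Delta> \<sigma>" "\<rho> \<subseteq> \<tau>" for \<tau> \<rho>
  proof -
    from \<tau> have "\<rho> \<union> \<sigma> \<subseteq> \<tau> \<union> \<sigma>" "\<tau> \<union> \<sigma> \<in> \<Delta>" "\<tau> \<in> \<Delta>" "\<rho> \<inter> \<sigma> = {}" by (auto simp: link_def)
    with \<tau> abstract_simplicial_complexD(3) [OF \<Delta>] show ?thesis unfolding link_def by blast
  qed
  moreover have "finite (link \<Delta> \<sigma>)" "\<forall>\<tau>\<in>link \<Delta> \<sigma>. finite \<tau>"
    using abstract_simplicial_complexD(1,2) [OF \<Delta>] by (simp_all add: link_def)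
  ultimately show ?thesis unfolding abstract_simplicial_complex_def by blast
qed

lemma link_not_face:
  "abstract_simplicial_complex \<Delta> \<Longrightarrow> \<sigma> \<notin> \<Delta> \<Longrightarrow> link \<Delta> \<sigma> = {}"
  using abstract_simplicial_complexD(3) unfolding link_def by blast

lemma link_Un:
  assumes "abstract_simplicial_complex \<Delta>" "abstract_simplicial_complex \<Gamma>"
  shows "link (\<Delta> \<union> \<Gamma>) \<sigma> = link \<Delta> \<sigma> \<union> link \<Gamma> \<sigma>"
  using assms [THEN abstract_simplicial_complexD(3)] unfolding link_def by blast

lemma link_Int: "link (\<Delta> \<inter> \<Gamma>) \<sigma> = link \<Delta> \<sigma> \<inter> link \<Gamma> \<sigma>"
  unfolding link_def by blast

lemma link_simplex: "\<sigma> \<subseteq> F \<Longrightarrow> link (Pow F) \<sigma> = Pow (F - \<sigma>)"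
  unfolding link_def by blast

text \<open>The bound is the dimension of the link of \<open>\<sigma>\<close> when all facets have
  \<open>n\<close> vertices. Links commute with unions and intersections, and the index drop for
  \<open>\<Delta> \<inter> \<Gamma>\<close> is the \<open>k - 1\<close> of Mayer--Vietoris.\<close>

lemma constructible_acyclic_link:
  fixes \<Delta> :: "'a::linorder set set"
  assumes "constructible n \<Delta>" "\<sigma> \<in> \<Delta>"
  shows "acyclic_below (int n - 1 - int (card \<sigma>)) (link \<Delta> \<sigma>)"
  using assms
proof (induction rule: constructible.induct)
  case (simplex F n)
  then have "card \<sigma> \<le> n" "card (F - \<sigma>) = n - card \<sigma>"
    by (auto simp: card_Diff_subset finite_subset intro: card_mono)
  then have "face_dim (F - \<sigma>) = int n - 1 - int (card \<sigma>)"
    by (simp add: face_dim_def of_nat_diff)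
  then show ?case
    using acyclic_below_simplex [of "F - \<sigma>"] simplex by (simp add: link_simplex)
next
  case (union n \<Delta> \<Gamma>)
  note cx = union(1,2) [THEN constructible_complex]
  let ?k = "int (Suc n) - 1 - int (card \<sigma>)"
  consider "\<sigma> \<in> \<Delta> \<inter> \<Gamma>" | "\<sigma> \<in> \<Delta>" "\<sigma> \<notin> \<Gamma>" | "\<sigma> \<notin> \<Delta>" "\<sigma> \<in> \<Gamma>" using union.prems by blast
  then show ?case
  proof cases
    case 1
    have k: "?k - 1 = int n - 1 - int (card \<sigma>)" by simp
    have "acyclic_below ?k (link \<Delta> \<sigma> \<union> link \<Gamma> \<sigma>)"
      by (rule acyclic_below_Un)
        (use 1 union.IH cx in \<open>simp_all only: k link_Int [symmetric] abstract_simplicial_complex_link Int_iff\<close>)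
    then show ?thesis by (simp only: link_Un [OF cx])
  next
    case 2
    \<comment> \<open>A non-face has empty link, so only one of the two parts contributes.\<close>
    then show ?thesis using union.IH(1) by (simp add: link_Un [OF cx] link_not_face [OF cx(2)])
  next
    case 3
    then show ?thesis using union.IH(2) by (simp add: link_Un [OF cx] link_not_face [OF cx(1)])
  qed
qed

theorem constructible_imp_cohen_macaulay:
  fixes \<Delta> :: "'a::linorder set set"
  assumes "constructible n \<Delta>"
  shows "cohen_macaulay \<Delta>"
  unfolding cohen_macaulay_def
proof (intro ballI allI impI)
  fix \<sigma> i assume \<sigma>: "\<sigma> \<in> \<Delta>" and i: "i < complex_dim (link \<Delta> \<sigma>)"
  note cx = constructible_complex [OF assms]
  \<comment> \<open>The empty face keeps the set nonempty over which \<open>complex_dim\<close>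
    takes \<open>Max\<close>.\<close>
  have "finite (link \<Delta> \<sigma>)" "{} \<in> link \<Delta> \<sigma>"
    using abstract_simplicial_complexD(1) [OF cx] constructible_empty_face [OF assms] \<sigma>
    by (simp_all add: link_def)
  \<comment> \<open>An upper bound on the dimension suffices: all degrees below the dimension of the
    link then lie in the range of vanishing.\<close>
  moreover have "face_dim \<tau> \<le> int n - 1 - int (card \<sigma>)" if "\<tau> \<in> link \<Delta> \<sigma>" for \<tau>
  proof -
    from that have "\<tau> \<in> \<Delta>" "\<tau> \<inter> \<sigma> = {}" "\<tau> \<union> \<sigma> \<in> \<Delta>" by (simp_all add: link_def)
    moreover from this \<sigma> have "finite \<tau>" "finite \<sigma>"
      using abstract_simplicial_complexD(2) [OF cx] by blast+
    ultimately have "card \<tau> + card \<sigma> \<le> n"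
      using constructible_card [OF assms, of "\<tau> \<union> \<sigma>"] by (simp add: card_Un_disjoint)
    then show ?thesis by (simp add: face_dim_def)
  qed
  ultimately have "complex_dim (link \<Delta> \<sigma>) \<le> int n - 1 - int (card \<sigma>)"
    unfolding complex_dim_def by (intro Max.boundedI) auto
  with i have "i < int n - 1 - int (card \<sigma>)" by simp
  with abstract_simplicial_complex_link [OF cx] constructible_acyclic_link [OF assms \<sigma>]
  show "trivial_group (reduced_simplicial_homology (link \<Delta> \<sigma>) i)"
    by (rule acyclic_below_trivial_homology)
qed


section \<open>Shellable complexes and gluings\<close>

lemma complex_of_insert: "complex_of (insert F \<F>) = Pow F \<union> complex_of \<F>"
  unfolding complex_of_def by blast

lemma simplex_Int_complex_of: "Pow F \<inter> complex_of \<F> = complex_of ((\<lambda>G. G \<inter> F) ` \<F>)"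
  by (auto simp: complex_of_def)

text \<open>These are the possible intersections of a new facet with the older ones in a shelling:
  the ridges of \<open>F\<close> opposite to the vertices in \<open>S\<close>. They are glued one by
  one, each meeting the others in a complex of the same kind.\<close>

lemma constructible_simplex_boundary_part:
  assumes "finite S" "S \<noteq> {}" "finite F" "S \<subseteq> F" "card F = Suc n"
  shows "constructible n (complex_of ((\<lambda>v. F - {v}) ` S))"
  using assms
proof (induction S arbitrary: F n rule: finite_ne_induct)
  case (singleton v)
  have "complex_of ((\<lambda>v. F - {v}) ` {v}) = Pow (F - {v})" by (auto simp: complex_of_def)
  then show ?case using singleton by (auto intro: constructible.simplex)
next
  case (insert v S)
  from insert have S: "S \<subseteq> F - {v}" and F: "finite (F - {v})" "card (F - {v}) = n" by auto
  have "card S > 0" using insert.hyps by (simp add: card_gt_0_iff)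
  then obtain m where n: "n = Suc m"
    using card_mono [OF F(1) S] F(2) by (cases n) auto
  have "constructible m (complex_of ((\<lambda>w. F - {v} - {w}) ` S))"
    by (rule insert.IH [OF F(1) S]) (simp add: F n)
  \<comment> \<open>The ridge opposite to \<open>v\<close> meets the other ridges in the part of its
    own boundary opposite to \<open>S\<close>.\<close>
  moreover have "complex_of ((\<lambda>w. F - {v} - {w}) ` S) =
      Pow (F - {v}) \<inter> complex_of ((\<lambda>w. F - {w}) ` S)"
    by (auto simp: complex_of_def)
  moreover have "constructible (Suc m) (Pow (F - {v}))"
    using F n by (auto intro: constructible.simplex)
  moreover have "constructible (Suc m) (complex_of ((\<lambda>w. F - {w}) ` S))"
    using insert.IH [of F n] insert.prems n by simp
  ultimately show ?case
    unfolding n image_insert complex_of_insert by (metis constructible.union)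
qed

text \<open>Facets are listed in reverse order: each one is attached to the complex of its successors.\<close>

primrec shelling :: "'a set list \<Rightarrow> bool" where
  "shelling [] \<longleftrightarrow> True"
| "shelling (F # Fs) \<longleftrightarrow>
     shelling Fs \<and> (\<forall>G\<in>set Fs. \<exists>v\<in>F - G. \<exists>H\<in>set Fs. F - {v} \<subseteq> H)"

text \<open>By the shelling condition, a face that \<open>F\<close> shares with an older facet lies
  in a whole ridge of \<open>F\<close> shared with some older facet. So \<open>F\<close> is attached
  along a part of its boundary, which is constructible.\<close>

lemma shelling_constructible:
  assumes "shelling Fs" "Fs \<noteq> []" "\<And>F. F \<in> set Fs \<Longrightarrow> finite F \<and> card F = n"
  shows "constructible n (complex_of (set Fs))"
  using assms
proof (induction Fs)
  case (Cons F Fs)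
  from Cons.prems(3) have F: "finite F" "card F = n" by auto
  show ?case
  proof (cases "Fs = []")
    case True
    have "complex_of {F} = Pow F" unfolding complex_of_def by blast
    with True F show ?thesis by (auto intro: constructible.simplex)
  next
    case False
    define S where "S = {v\<in>F. \<exists>H\<in>set Fs. F - {v} \<subseteq> H}"
    have S: "\<exists>v\<in>S. v \<notin> G" if "G \<in> set Fs" for G
    proof -
      have "\<exists>v\<in>F - G. \<exists>H\<in>set Fs. F - {v} \<subseteq> H" using Cons.prems(1) that by simp
      then show ?thesis unfolding S_def by blast
    qed
    obtain G where "G \<in> set Fs" using False by (metis list.set_sel(1))
    then have "S \<noteq> {}" using S by blast
    moreover have "S \<subseteq> F" by (auto simp: S_def)
    moreover from calculation obtain m where n: "n = Suc m" using F by (cases n) auto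
    ultimately have bd: "constructible m (complex_of ((\<lambda>v. F - {v}) ` S))"
      using F finite_subset by (intro constructible_simplex_boundary_part) auto
    have "complex_of ((\<lambda>v. F - {v}) ` S) = complex_of ((\<lambda>G. G \<inter> F) ` set Fs)"
    proof
      show "complex_of ((\<lambda>v. F - {v}) ` S) \<subseteq> complex_of ((\<lambda>G. G \<inter> F) ` set Fs)"
      proof
        fix \<sigma> assume "\<sigma> \<in> complex_of ((\<lambda>v. F - {v}) ` S)"
        then obtain v where v: "v \<in> S" "\<sigma> \<subseteq> F - {v}" by (auto simp: complex_of_def)
        from v(1) obtain H where "H \<in> set Fs" "F - {v} \<subseteq> H" by (auto simp: S_def)
        moreover from this v(2) have "\<sigma> \<subseteq> H \<inter> F" by blast
        ultimately show "\<sigma> \<in> complex_of ((\<lambda>G. G \<inter> F) ` set Fs)"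
          by (auto simp: complex_of_def)
      qed
      show "complex_of ((\<lambda>G. G \<inter> F) ` set Fs) \<subseteq> complex_of ((\<lambda>v. F - {v}) ` S)"
      proof
        fix \<sigma> assume "\<sigma> \<in> complex_of ((\<lambda>G. G \<inter> F) ` set Fs)"
        then obtain G where G: "G \<in> set Fs" "\<sigma> \<subseteq> G" "\<sigma> \<subseteq> F" by (auto simp: complex_of_def)
        with S obtain v where "v \<in> S" "v \<notin> G" by blast
        then show "\<sigma> \<in> complex_of ((\<lambda>v. F - {v}) ` S)"
          using G by (auto simp: complex_of_def)
      qed
    qed
    with bd have "constructible m (Pow F \<inter> complex_of (set Fs))"
      by (simp only: simplex_Int_complex_of)
    moreover have "constructible (Suc m) (complex_of (set Fs))"
      using Cons.IH Cons.prems False n by simp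
    moreover have "constructible (Suc m) (Pow F)" using F n by (auto intro: constructible.simplex)
    ultimately show ?thesis
      by (simp add: n complex_of_insert constructible.union)
  qed
qed simp

lemma constructible_image:
  assumes "constructible n \<Delta>" "inj f"
  shows "constructible n ((`) f ` \<Delta>)"
  using assms(1)
proof (induction rule: constructible.induct)
  case (simplex F n)
  have "(`) f ` Pow F = Pow (f ` F)" by (rule image_Pow_surj) simp
  moreover have "card (f ` F) = card F"
    using assms(2) by (intro card_image) (auto intro: inj_on_subset)
  ultimately show ?case using simplex by (auto intro: constructible.simplex)
next
  case (union n \<Delta> \<Gamma>)
  have "inj ((`) f)" using assms(2) by (simp add: inj_image_eq_iff inj_def)
  then show ?case
    using union.IH by (simp add: image_Un image_Int constructible.union)
qed

lemma inj_glue_vertex: "inj (glue_vertex A j)"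
  by (simp add: inj_def glue_vertex_eq_iff)

text \<open>The code of a vertex determines the vertex, and off \<open>A\<close> also the copy.
  Hence distinct copies share only faces on the vertices of \<open>A\<close>, and every other face
  remembers its copy.\<close>

lemma glue_vertex_image_eq_iff:
  "glue_vertex A j ` \<sigma> = glue_vertex A k ` \<tau> \<longleftrightarrow> \<sigma> = \<tau> \<and> (j = k \<or> \<sigma> \<subseteq> \<Union>A)"
proof (cases "j = k")
  case True
  then show ?thesis by (simp add: inj_image_eq_iff inj_glue_vertex)
next
  case False
  show ?thesis
  proof
    assume eq: "glue_vertex A j ` \<sigma> = glue_vertex A k ` \<tau>"
    have "v \<in> \<tau> \<and> v \<in> \<Union>A" if "v \<in> \<sigma>" for v
    proof -
      from that eq have "glue_vertex A j v \<in> glue_vertex A k ` \<tau>" by blast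
      then show ?thesis using False by (auto simp del: Union_iff simp: glue_vertex_eq_iff)
    qed
    moreover have "v \<in> \<sigma>" if "v \<in> \<tau>" for v
    proof -
      from that eq have "glue_vertex A k v \<in> glue_vertex A j ` \<sigma>" by blast
      then show ?thesis by (auto simp: glue_vertex_eq_iff)
    qed
    ultimately show "\<sigma> = \<tau> \<and> (j = k \<or> \<sigma> \<subseteq> \<Union>A)" by blast
  next
    assume "\<sigma> = \<tau> \<and> (j = k \<or> \<sigma> \<subseteq> \<Union>A)"
    then show "glue_vertex A j ` \<sigma> = glue_vertex A k ` \<tau>"
      using False by (intro image_cong) (auto simp: glue_vertex_def)
  qed
qed

text \<open>Copies are added one at a time. As \<open>A\<close> is induced, each new copy meets the
  union of the previous ones in a copy of \<open>A\<close>, whose index is one less.\<close>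

lemma constructible_glue_copies:
  assumes "constructible (Suc n) \<Delta>" "constructible n A" "A = induced_subcomplex \<Delta> (\<Union>A)"
  shows "constructible (Suc n) (glue_copies (Suc k) \<Delta> A)"
proof (induction k)
  case 0
  then show ?case
    using constructible_image [OF assms(1) inj_glue_vertex] by (simp add: glue_copies_def lessThan_Suc)
next
  case (Suc k)
  let ?copy = "\<lambda>j. (`) (glue_vertex A j) ` \<Delta>"
  have A: "\<sigma> \<in> A \<longleftrightarrow> \<sigma> \<in> \<Delta> \<and> \<sigma> \<subseteq> \<Union>A" for \<sigma>
    using assms(3) by (auto simp: induced_subcomplex_def)
  have "glue_copies (Suc k) \<Delta> A \<inter> ?copy (Suc k) = (`) (glue_vertex A 0) ` A"
  proof (intro equalityI subsetI)
    fix \<rho> assume "\<rho> \<in> glue_copies (Suc k) \<Delta> A \<inter> ?copy (Suc k)"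
    then obtain j \<sigma> \<tau> where \<sigma>: "j < Suc k" "\<sigma> \<in> \<Delta>" "\<rho> = glue_vertex A j ` \<sigma>"
      and \<tau>: "\<rho> = glue_vertex A (Suc k) ` \<tau>"
      by (auto simp: glue_copies_def)
    then have sub: "\<sigma> \<subseteq> \<Union>A" using glue_vertex_image_eq_iff [of A j \<sigma> "Suc k" \<tau>] by auto
    then have "\<rho> = glue_vertex A 0 ` \<sigma>" unfolding \<sigma>(3) glue_vertex_image_eq_iff by blast
    with sub \<sigma>(2) A show "\<rho> \<in> (`) (glue_vertex A 0) ` A" by blast
  next
    fix \<rho> assume "\<rho> \<in> (`) (glue_vertex A 0) ` A"
    then obtain \<sigma> where \<sigma>: "\<sigma> \<in> A" "\<rho> = glue_vertex A 0 ` \<sigma>" by blast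
    with A have "\<sigma> \<in> \<Delta>" "\<sigma> \<subseteq> \<Union>A" by blast+
    moreover from this \<sigma>(2) have "\<rho> = glue_vertex A (Suc k) ` \<sigma>"
      by (simp add: glue_vertex_image_eq_iff)
    ultimately have "\<rho> \<in> ?copy 0" "\<rho> \<in> ?copy (Suc k)" using \<sigma>(2) by blast+
    then show "\<rho> \<in> glue_copies (Suc k) \<Delta> A \<inter> ?copy (Suc k)"
      unfolding glue_copies_def by (intro IntI UN_I [of 0]) simp_all
  qed
  moreover have "glue_copies (Suc (Suc k)) \<Delta> A = glue_copies (Suc k) \<Delta> A \<union> ?copy (Suc k)"
    by (simp add: glue_copies_def lessThan_Suc Un_commute)
  ultimately show ?case
    using Suc constructible_image [OF assms(1) inj_glue_vertex]
      constructible_image [OF assms(2) inj_glue_vertex]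
    by (simp add: constructible.union)
qed

lemma constructible_X: "constructible 4 X_complex"
proof -
  \<comment> \<open>The list is reversed because \<open>shelling\<close> attaches the head to the
    tail.\<close>
  define Fs :: "nat set list" where "Fs = rev
    [{1,2,4,9}, {1,2,6,9}, {1,5,6,9}, {1,5,8,9}, {1,4,8,9}, {1,4,5,8}, {1,4,5,7},
     {4,5,7,8}, {1,2,5,6}, {0,1,2,5}, {0,2,5,6}, {0,1,2,3}, {1,2,3,4}, {1,3,4,7}]"
  have set: "set Fs = X_facets" by (auto simp only: Fs_def X_facets_def set_rev list.set)
  have "shelling Fs" "Fs \<noteq> []" by (simp_all add: Fs_def insert_Diff_if)
  then show ?thesis
    using shelling_constructible [of Fs 4] X_facets_card by (simp add: set X_complex_def)
qed

lemma constructible_A: "constructible 3 A_complex"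
proof -
  define Fs :: "nat set list" where "Fs = rev [{0,2,6}, {0,2,3}, {2,3,4}, {3,4,7}, {4,7,8}]"
  have set: "set Fs = A_facets" by (auto simp only: Fs_def A_facets_def set_rev list.set)
  have "shelling Fs" "Fs \<noteq> []" by (simp_all add: Fs_def insert_Diff_if)
  then show ?thesis
    using shelling_constructible [of Fs 3] A_facets_card by (simp add: set A_complex_def)
qed

lemma constructible_C3: "constructible 4 C3"
  \<comment> \<open>The successors of 3 and 2 give the index 4 and the three copies.\<close>
  using constructible_glue_copies [of 3 X_complex A_complex 2]
    constructible_X constructible_A A_induced
  by (simp add: C3_def vertices_A)


section \<open>Non-partitionability\<close>

text \<open>
  In the proof, \<open>covq\<close> records which facets can cover the face \<open>q\<close>. The argument for \<open>48\<close> is the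
  mirror image of the one for \<open>26\<close> under the automorphism of \<open>X\<close> swapping \<open>0, 2, 6\<close> with
  \<open>7, 4, 8\<close>.
\<close>

lemma X_relative_partition_covers:
  fixes R :: "nat set \<Rightarrow> nat set"
  assumes sub: "\<And>F. F \<in> X_facets \<Longrightarrow> R F \<subseteq> F"
    and cov: "\<And>\<sigma>. \<sigma> \<in> X_complex \<Longrightarrow> \<sigma> \<notin> A_complex \<Longrightarrow> \<exists>F\<in>X_facets. R F \<subseteq> \<sigma> \<and> \<sigma> \<subseteq> F"
    and disj: "\<And>F G \<sigma>. F \<in> X_facets \<Longrightarrow> G \<in> X_facets \<Longrightarrow> R F \<subseteq> \<sigma> \<Longrightarrow> \<sigma> \<subseteq> F \<Longrightarrow>
      R G \<subseteq> \<sigma> \<Longrightarrow> \<sigma> \<subseteq> G \<Longrightarrow> F = G"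
  shows "(\<exists>F\<in>X_facets. R F \<subseteq> {2,6} \<and> {2,6} \<subseteq> F) \<or> (\<exists>F\<in>X_facets. R F \<subseteq> {4,8} \<and> {4,8} \<subseteq> F)"
proof (rule ccontr)
  assume neg: "\<not> ?thesis"
  \<comment> \<open>Membership in \<open>X\<close> and \<open>A\<close> is reduced to the facet
    lists, which the simplifier can search.\<close>
  have cov': "\<exists>F\<in>X_facets. R F \<subseteq> \<sigma> \<and> \<sigma> \<subseteq> F"
    if "\<exists>F\<in>X_facets. \<sigma> \<subseteq> F" "\<forall>F\<in>A_facets. \<not> \<sigma> \<subseteq> F" for \<sigma>
    using cov [of \<sigma>] that by (auto simp: X_complex_def A_complex_def complex_of_def)
  have cov269: "R {1,2,6,9} \<subseteq> {2,6,9}"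
    using cov' [of "{2,6,9}"] by (simp add: X_facets_def A_facets_def)
  have cov489: "R {1,4,8,9} \<subseteq> {4,8,9}"
    using cov' [of "{4,8,9}"] by (simp add: X_facets_def A_facets_def)
  have cov015: "R {0,1,2,5} \<subseteq> {0,1,5}"
    using cov' [of "{0,1,5}"] by (simp add: X_facets_def A_facets_def)
  have cov157: "R {1,4,5,7} \<subseteq> {1,5,7}"
    using cov' [of "{1,5,7}"] by (simp add: X_facets_def A_facets_def)
  have cov056: "R {0,2,5,6} \<subseteq> {0,5,6}"
    using cov' [of "{0,5,6}"] by (simp add: X_facets_def A_facets_def)
  have cov578: "R {4,5,7,8} \<subseteq> {5,7,8}"
    using cov' [of "{5,7,8}"] by (simp add: X_facets_def A_facets_def)
  have cov126: "R {1,2,6,9} \<subseteq> {1,2,6} \<or> R {1,2,5,6} \<subseteq> {1,2,6}"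
    using cov' [of "{1,2,6}"] by (simp add: X_facets_def A_facets_def)
  have cov148: "R {1,4,8,9} \<subseteq> {1,4,8} \<or> R {1,4,5,8} \<subseteq> {1,4,8}"
    using cov' [of "{1,4,8}"] by (simp add: X_facets_def A_facets_def)
  have cov25: "R {1,2,5,6} \<subseteq> {2,5} \<or> R {0,1,2,5} \<subseteq> {2,5} \<or> R {0,2,5,6} \<subseteq> {2,5}"
    using cov' [of "{2,5}"] by (simp add: X_facets_def A_facets_def)
  have cov45: "R {1,4,5,8} \<subseteq> {4,5} \<or> R {1,4,5,7} \<subseteq> {4,5} \<or> R {4,5,7,8} \<subseteq> {4,5}"
    using cov' [of "{4,5}"] by (simp add: X_facets_def A_facets_def)
  have neg26: "\<not> R {1,2,6,9} \<subseteq> {2,6}" "\<not> R {1,2,5,6} \<subseteq> {2,6}"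
    using neg by (simp_all add: X_facets_def)
  from cov269 neg26(1) have "9 \<in> R {1,2,6,9}" by auto
  with cov126 have "R {1,2,5,6} \<subseteq> {1,2,6}" by auto
  with neg26(2) have "1 \<in> R {1,2,5,6}" by auto
  with cov25 have "R {0,1,2,5} \<subseteq> {2,5} \<or> R {0,2,5,6} \<subseteq> {2,5}" by auto
  then have c1: "R {0,1,2,5} \<subseteq> {5} \<or> R {0,2,5,6} \<subseteq> {5}"
    using cov015 cov056 by auto
  have neg48: "\<not> R {1,4,8,9} \<subseteq> {4,8}" "\<not> R {1,4,5,8} \<subseteq> {4,8}"
    using neg by (simp_all add: X_facets_def)
  from cov489 neg48(1) have "9 \<in> R {1,4,8,9}" by auto
  with cov148 have "R {1,4,5,8} \<subseteq> {1,4,8}" by auto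
  with neg48(2) have "1 \<in> R {1,4,5,8}" by auto
  with cov45 have "R {1,4,5,7} \<subseteq> {4,5} \<or> R {4,5,7,8} \<subseteq> {4,5}" by auto
  then have c2: "R {1,4,5,7} \<subseteq> {5} \<or> R {4,5,7,8} \<subseteq> {5}"
    using cov157 cov578 by auto
  \<comment> \<open>The vertex 4 separates the two facets whose intervals contain
    \<open>{5}\<close>: neither 0125 nor 0256 contains it, while 1457 and 4578 do.\<close>
  from c1 have "\<exists>F\<in>X_facets. R F \<subseteq> {5} \<and> {5} \<subseteq> F \<and> 4 \<notin> F"
    by (elim disjE) (simp_all add: X_facets_def)
  then obtain F where F: "F \<in> X_facets" "R F \<subseteq> {5}" "{5} \<subseteq> F" "4 \<notin> F" by blast
  from c2 have "\<exists>G\<in>X_facets. R G \<subseteq> {5} \<and> {5} \<subseteq> G \<and> 4 \<in> G"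
    by (elim disjE) (simp_all add: X_facets_def)
  then obtain G where G: "G \<in> X_facets" "R G \<subseteq> {5}" "{5} \<subseteq> G" "4 \<in> G" by blast
  have "F = G" by (rule disj [OF F(1) G(1) F(2,3) G(2,3)])
  with F(4) G(4) show False by simp
qed

lemma not_partitionable_C3: "\<not> partitionable C3"
proof
  assume "partitionable C3"
  then obtain R where R_sub: "\<And>F. F \<in> C3_facets \<Longrightarrow> R F \<subseteq> F"
    and R_disj: "disjoint_family_on (\<lambda>F. face_interval C3 (R F) F) C3_facets"
    and R_cov: "C3 = (\<Union>F\<in>C3_facets. face_interval C3 (R F) F)"
    unfolding partitionable_def facets_C3 by blast
  define g where "g = glue_vertex A_complex"
  have inj: "inj (g j)" for j unfolding g_def by (rule inj_glue_vertex)
  have disj: "F = G" if "F \<in> C3_facets" "G \<in> C3_facets" "R F \<subseteq> \<sigma>" "\<sigma> \<subseteq> F" "R G \<subseteq> \<sigma>" "\<sigma> \<subseteq> G"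
    for F G \<sigma>
  proof (rule ccontr)
    assume "F \<noteq> G"
    have "\<sigma> \<in> C3" using that by (auto simp: C3_eq complex_of_def)
    then have "\<sigma> \<in> face_interval C3 (R F) F \<inter> face_interval C3 (R G) G"
      using that by (simp add: face_interval_def)
    then show False using R_disj that \<open>F \<noteq> G\<close> by (auto simp: disjoint_family_on_def)
  qed
  have copy: "g j ` F \<in> C3_facets" if "j < 3" "F \<in> X_facets" for j F
    using that by (auto simp: C3_facets_def g_def)
  define covered where
    "covered j \<sigma> \<longleftrightarrow> (\<exists>F\<in>X_facets. R (g j ` F) \<subseteq> g j ` \<sigma> \<and> \<sigma> \<subseteq> F)" for j \<sigma>
  have "covered j {2,6} \<or> covered j {4,8}" if j: "j < 3" for j
  proof -
    \<comment> \<open>The lower ends in copy \<open>j\<close> are pulled back to \<open>X\<close>.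
      Nothing is lost, as they lie in the range of \<open>g j\<close>.\<close>
    define r where "r F = g j -` R (g j ` F)" for F
    have r_iff: "r F \<subseteq> \<sigma> \<longleftrightarrow> R (g j ` F) \<subseteq> g j ` \<sigma>" if "F \<in> X_facets" for F \<sigma>
    proof -
      have "R (g j ` F) \<subseteq> range (g j)" using R_sub [OF copy [OF j that]] by blast
      then have "R (g j ` F) = g j ` r F" by (auto simp: r_def)
      then show ?thesis using inj by (simp add: inj_image_subset_iff)
    qed
    have "(\<exists>F\<in>X_facets. r F \<subseteq> {2,6} \<and> {2,6} \<subseteq> F) \<or> (\<exists>F\<in>X_facets. r F \<subseteq> {4,8} \<and> {4,8} \<subseteq> F)"
    proof (rule X_relative_partition_covers)
      show "r F \<subseteq> F" if "F \<in> X_facets" for F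
        using that R_sub [OF copy [OF j that]] by (simp add: r_iff)
    next
      fix \<sigma> assume \<sigma>: "\<sigma> \<in> X_complex" "\<sigma> \<notin> A_complex"
      then have "g j ` \<sigma> \<in> C3" using j by (auto simp: C3_def glue_copies_def g_def)
      then have "g j ` \<sigma> \<in> (\<Union>F\<in>C3_facets. face_interval C3 (R F) F)" using R_cov by simp
      then obtain G where G: "G \<in> C3_facets" "R G \<subseteq> g j ` \<sigma>" "g j ` \<sigma> \<subseteq> G"
        by (auto simp: face_interval_def)
      then obtain k F where F: "F \<in> X_facets" and GF: "G = g k ` F"
        by (auto simp: C3_facets_def g_def)
      from G(3) obtain \<tau> where \<tau>: "\<tau> \<subseteq> F" "g j ` \<sigma> = g k ` \<tau>"
        unfolding GF by (auto simp: subset_image_iff)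
      \<comment> \<open>As \<open>A\<close> is induced, \<open>\<sigma>\<close> has a vertex off
        \<open>A\<close>; that vertex forces the covering facet to come from copy
        \<open>j\<close>.\<close>
      have "\<not> \<sigma> \<subseteq> \<Union>A_complex"
        using \<sigma> A_induced by (auto simp: vertices_A induced_subcomplex_def)
      with \<tau>(2) have "\<tau> = \<sigma>" "k = j"
        unfolding g_def glue_vertex_image_eq_iff by auto
      then show "\<exists>F\<in>X_facets. r F \<subseteq> \<sigma> \<and> \<sigma> \<subseteq> F" using F G(2) \<tau>(1) GF r_iff by blast
    next
      fix F G \<sigma>
      assume FG: "F \<in> X_facets" "G \<in> X_facets" and *: "r F \<subseteq> \<sigma>" "\<sigma> \<subseteq> F" "r G \<subseteq> \<sigma>" "\<sigma> \<subseteq> G"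
      then have "g j ` F = g j ` G"
        using disj [OF copy [OF j FG(1)] copy [OF j FG(2)], of "g j ` \<sigma>"]
        by (simp add: r_iff image_mono)
      then show "F = G" using inj by (simp add: inj_image_eq_iff)
    qed
    then show ?thesis by (simp add: covered_def r_iff cong: bex_cong)
  qed
  moreover have "\<not> (covered j \<sigma> \<and> covered k \<sigma>)"
    if jk: "j < 3" "k < 3" "j \<noteq> k" and \<sigma>: "\<sigma> \<subseteq> \<Union>A_complex" for j k \<sigma>
  proof
    assume "covered j \<sigma> \<and> covered k \<sigma>"
    then obtain F G where F: "F \<in> X_facets" "R (g j ` F) \<subseteq> g j ` \<sigma>" "\<sigma> \<subseteq> F"
      and G: "G \<in> X_facets" "R (g k ` G) \<subseteq> g k ` \<sigma>" "\<sigma> \<subseteq> G"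
      by (auto simp: covered_def)
    have "g k ` \<sigma> = g j ` \<sigma>" unfolding g_def glue_vertex_image_eq_iff using \<sigma> by blast
    then have "g j ` F = g k ` G"
      using disj [OF copy [OF jk(1) F(1)] copy [OF jk(2) G(1)], of "g j ` \<sigma>"] F G
      by (metis image_mono)
    \<comment> \<open>A facet common to two copies would have all its vertices in \<open>A\<close>,
      but no facet of \<open>X\<close> does.\<close>
    then have "F \<subseteq> \<Union>A_complex" using jk(3) unfolding g_def glue_vertex_image_eq_iff by blast
    moreover have "\<forall>F\<in>X_facets. \<not> F \<subseteq> {0,2,3,4,6,7,8}" by (simp add: X_facets_def)
    ultimately show False using F(1) by (simp add: vertices_A)
  qed
  then have "\<not> (covered j {2,6} \<and> covered k {2,6})" "\<not> (covered j {4,8} \<and> covered k {4,8})"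
    if "j < 3" "k < 3" "j \<noteq> k" for j k
    using that by (simp_all add: vertices_A)
  \<comment> \<open>The pigeonhole principle for the copies 0, 1, 2 and the faces 26 and 48.\<close>
  moreover have "(0::nat) < 3" "(1::nat) < 3" "(2::nat) < 3" "(0::nat) \<noteq> 1" "(0::nat) \<noteq> 2" "(1::nat) \<noteq> 2"
    by simp_all
  ultimately show False by metis
qed

theorem theorem3p5:
  shows "cohen_macaulay C3 \<and> \<not> partitionable C3"
  using constructible_imp_cohen_macaulay [OF constructible_C3] not_partitionable_C3 by blast

end
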